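(* Let $B$ be a set of cells of an $m\times n$ array having exactly $h$ cells in each row and exactly $k$ cells in each column. Let $G$ be a finite group of order $v$ and $J$ a subgroup of order $t$, and let $\lambda$ be a positive integer such that $nk=mh$, $v=\frac{2nk}{\lambda}+t$, $t\mid v$, and if $G\setminus J$ contains an involution then $\lambda$ is even. Suppose that $B$ can be partitioned into nice tiles $T_1,\dots,T_\ell$ and that $v-t\ge\max_i |T_i|$. Then there exists a ${}^\lambda\mathrm{NH}_t(m,n;h,k)$ over $G$ relative to $J$.
   Context: Groups are written additively (not necessarily abelian). Cells of an $m\times n$ array are pairs $(i,j)$, $i\in\{1,\dots,m\}$, $j\in\{1,\dots,n\}$, with row indices taken modulo $m$ and column indices modulo $n$. A partially filled (p.f.) array over $G$ is an array whose cells are empty or contain elements of $G$; $skel(A)$ is its set of filled cells. A set $T$ of cells of an $m\times n$ array is a nice tile if for every group $G$, every subset $S\subseteq G$ with $|S|=|T|$, and all vectors $(r_1,\dots,r_m)\in G^m$, $(c_1,\dots,c_n)\in G^n$, there is a p.f. array $A$ with $skel(A)=T$ whose entries are exactly the elements of $S$, each used once, such that: for every row $i$ meeting $T$, with $h_i$ the number of cells of $T$ in row $i$, there is $\beta_i$ with the cells of $T$ in row $i$ equal to $(i,\beta_i),(i,\beta_i+1),\dots,(i,\beta_i+h_i-1)$, and the sum of the entries of row $i$ taken in this order is different from $r_i$; and for every column $j$ meeting $T$, with $k_j$ the number of cells of $T$ in column $j$, there is $\gamma_j$ with the cells of $T$ in column $j$ equal to $(\gamma_j,j),(\gamma_j+1,j),\dots,(\gamma_j+k_j-1,j)$,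 and the sum of the entries of column $j$ taken in this order is different from $c_j$. A ${}^\lambda\mathrm{NH}_t(m,n;h,k)$ over $G$ relative to $J$ is an $m\times n$ p.f. array over $G$ with exactly $h$ filled cells per row and $k$ per column, such that the multiset obtained by taking, for every filled cell with entry $x$, both $x$ and $-x$ (with multiplicity) is exactly each element of $G\setminus J$ with multiplicity $\lambda$, and such that every row sum (left to right) and column sum (top to bottom) is nonzero. *)

theory Defs
  imports Complex_Main "HOL-Algebra.Generated_Groups" "HOL-Library.Multiset"
    "HOL-Library.Disjoint_Sets" "HOL-Library.Countable_Set"
begin

text \<open>
  Groups are not assumed abelian. They are those of HOL-Algebra, so the sum, zero and negation of
  additive notation are \<open>\<otimes>\<close>, \<open>\<one>\<close> and \<open>inv\<close>. A partially filled array is a partial function on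
  cells; its skeleton is its domain \<open>dom A\<close>.
\<close>

definition cells :: "nat \<Rightarrow> nat \<Rightarrow> (nat \<times> nat) set" where
  "cells m n = {1..m} \<times> {1..n}"

definition row_cells :: "(nat \<times> nat) set \<Rightarrow> nat \<Rightarrow> nat set" where
  "row_cells T i = {j. (i, j) \<in> T}"

definition col_cells :: "(nat \<times> nat) set \<Rightarrow> nat \<Rightarrow> nat set" where
  "col_cells T j = {i. (i, j) \<in> T}"

definition pf_array :: "('a, 'b) monoid_scheme \<Rightarrow> nat \<Rightarrow> nat \<Rightarrow> (nat \<times> nat \<rightharpoonup> 'a) \<Rightarrow> bool" where
  "pf_array G m n A \<longleftrightarrow> dom A \<subseteq> cells m n \<and> ran A \<subseteq> carrier G"

definition gsum :: "('a, 'b) monoid_scheme \<Rightarrow> 'a list \<Rightarrow> 'a" where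
  "gsum G xs = foldr (\<otimes>\<^bsub>G\<^esub>) xs \<one>\<^bsub>G\<^esub>"

text \<open>The indices \<open>b, b + 1, \<dots>, b + h - 1\<close> modulo \<open>n\<close>, with representatives in \<open>{1..n}\<close>
  (intended for \<open>b \<in> {1..n}\<close>).\<close>

definition cyc_list :: "nat \<Rightarrow> nat \<Rightarrow> nat \<Rightarrow> nat list" where
  "cyc_list n b h = map (\<lambda>s. (b - 1 + s) mod n + 1) [0..<h]"

definition nice_tile_over ::
    "('a, 'b) monoid_scheme \<Rightarrow> nat \<Rightarrow> nat \<Rightarrow> (nat \<times> nat) set \<Rightarrow> bool" where
  "nice_tile_over G m n T \<longleftrightarrow>
     T \<subseteq> cells m n \<and>
     (\<forall>S r c. S \<subseteq> carrier G \<longrightarrow> finite S \<longrightarrow> card S = card T \<longrightarrow>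
        (\<forall>i\<in>{1..m}. r i \<in> carrier G) \<longrightarrow> (\<forall>j\<in>{1..n}. c j \<in> carrier G) \<longrightarrow>
        (\<exists>A. pf_array G m n A \<and> dom A = T \<and> bij_betw (\<lambda>x. the (A x)) T S \<and>
           (\<forall>i\<in>{1..m}. row_cells T i \<noteq> {} \<longrightarrow>
              (\<exists>\<beta>\<in>{1..n}. let js = cyc_list n \<beta> (card (row_cells T i)) in
                 set js = row_cells T i \<and> gsum G (map (\<lambda>j. the (A (i, j))) js) \<noteq> r i)) \<and>
           (\<forall>j\<in>{1..n}. col_cells T j \<noteq> {} \<longrightarrow>
              (\<exists>\<gamma>\<in>{1..m}. let is = cyc_list m \<gamma> (card (col_cells T j)) in
                 set is = col_cells T j \<and> gsum G (map (\<lambda>i. the (A (i, j))) is) \<noteq> c j))))"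

text \<open>
  HOL cannot quantify over the groups of all types inside a definition. Quantifying over the
  groups with carrier in \<open>nat\<close> loses nothing: only finitely many group elements occur in
  \<open>nice_tile_over\<close>, and they generate a countable group. The lemma \<open>nice_tile_any_group\<close> below
  recovers the property for groups of every type.
\<close>

definition nice_tile :: "nat \<Rightarrow> nat \<Rightarrow> (nat \<times> nat) set \<Rightarrow> bool" where
  "nice_tile m n T \<longleftrightarrow>
     T \<subseteq> cells m n \<and> (\<forall>G :: nat monoid. group G \<longrightarrow> nice_tile_over G m n T)"

text \<open>\<open>map_filter\<close> skips the empty cells, so the two sums below run over the filled cells of a
  row from left to right and of a column from top to bottom.\<close>

definition row_sum :: "('a, 'b) monoid_scheme \<Rightarrow> nat \<Rightarrow> (nat \<times> nat \<rightharpoonup> 'a) \<Rightarrow> nat \<Rightarrow> 'a" where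
  "row_sum G n A i = gsum G (List.map_filter (\<lambda>j. A (i, j)) [1..<Suc n])"

definition col_sum :: "('a, 'b) monoid_scheme \<Rightarrow> nat \<Rightarrow> (nat \<times> nat \<rightharpoonup> 'a) \<Rightarrow> nat \<Rightarrow> 'a" where
  "col_sum G m A j = gsum G (List.map_filter (\<lambda>i. A (i, j)) [1..<Suc m])"

text \<open>\<open>is_NH G J l t m n h k A\<close>: the array \<open>A\<close> is a \<open>\<^sup>lNH\<^sub>t(m,n;h,k)\<close> over the finite group \<open>G\<close>
  relative to \<open>J\<close>.\<close>

definition is_NH :: "('a, 'b) monoid_scheme \<Rightarrow> 'a set \<Rightarrow> nat \<Rightarrow> nat \<Rightarrow> nat \<Rightarrow> nat \<Rightarrow> nat \<Rightarrow> nat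
    \<Rightarrow> (nat \<times> nat \<rightharpoonup> 'a) \<Rightarrow> bool" where
  "is_NH G J l t m n h k A \<longleftrightarrow>
     group G \<and> finite (carrier G) \<and> subgroup J G \<and> card J = t \<and>
     pf_array G m n A \<and>
     (\<forall>i\<in>{1..m}. card (row_cells (dom A) i) = h) \<and>
     (\<forall>j\<in>{1..n}. card (col_cells (dom A) j) = k) \<and>
     image_mset (\<lambda>x. the (A x)) (mset_set (dom A)) +
       image_mset (\<lambda>x. inv\<^bsub>G\<^esub> (the (A x))) (mset_set (dom A)) =
       repeat_mset l (mset_set (carrier G - J)) \<and>
     (\<forall>i\<in>{1..m}. row_sum G n A i \<noteq> \<one>\<^bsub>G\<^esub>) \<and>
     (\<forall>j\<in>{1..n}. col_sum G m A j \<noteq> \<one>\<^bsub>G\<^esub>)"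

lemma (in group) countable_generate:
  assumes "countable X" "X \<subseteq> carrier G"
  shows "countable (generate G X)"
proof -
  let ?Y = "X \<union> m_inv G ` X"
  let ?F = "\<lambda>xs. gsum G xs"
  have Y: "?Y \<subseteq> carrier G" using assms(2) by auto
  have closed: "?F xs \<in> carrier G" if "set xs \<subseteq> carrier G" for xs
    using that by (induction xs) (auto simp: gsum_def)
  have app: "?F (xs @ ys) = ?F xs \<otimes> ?F ys"
    if "set xs \<subseteq> carrier G" "set ys \<subseteq> carrier G" for xs ys
    using that closed by (induction xs) (auto simp: gsum_def m_assoc)
  have "generate G X \<subseteq> ?F ` lists ?Y"
  proof
    fix x assume "x \<in> generate G X"
    then show "x \<in> ?F ` lists ?Y"
    proof induction
      case one
      then show ?case by (intro image_eqI[of _ _ "[]"]) (auto simp: gsum_def)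
    next
      case (incl h)
      then show ?case using assms(2)
        by (intro image_eqI[of _ _ "[h]"]) (auto simp: gsum_def)
    next
      case (inv h)
      then have "h \<in> carrier G" using assms(2) by auto
      with inv show ?case
        by (intro image_eqI[of _ _ "[inv h]"]) (auto simp: gsum_def)
    next
      case (eng h1 h2)
      then obtain xs ys where *: "xs \<in> lists ?Y" "ys \<in> lists ?Y" "h1 = ?F xs" "h2 = ?F ys"
        by blast
      then have "set xs \<subseteq> carrier G" "set ys \<subseteq> carrier G" using Y by (auto simp: in_lists_conv_set)
      then have "h1 \<otimes> h2 = ?F (xs @ ys)" using * app by simp
      then show ?case using * by (intro image_eqI[of _ _ "xs @ ys"]) auto
    qed
  qed
  moreover have "countable (?F ` lists ?Y)" using assms(1) by auto
  ultimately show ?thesis by (rule countable_subset)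
qed

lemma nice_tile_any_group:
  fixes G :: "('a, 'b) monoid_scheme" (structure)
  assumes nice: "nice_tile m n T" and G: "group G"
  shows "nice_tile_over G m n T"
  unfolding nice_tile_over_def
proof (intro conjI allI impI)
  interpret group G by (rule G)
  show T: "T \<subseteq> cells m n" using nice by (simp add: nice_tile_def)
  fix S r c
  assume S: "S \<subseteq> carrier G" "finite S" "card S = card T"
    and r: "\<forall>i\<in>{1..m}. r i \<in> carrier G" and c: "\<forall>j\<in>{1..n}. c j \<in> carrier G"
  define X where "X = S \<union> r ` {1..m} \<union> c ` {1..n}"
  have X: "X \<subseteq> carrier G" "finite X" using S r c by (auto simp: X_def)
  define K where "K = generate G X"
  have cK: "countable K" unfolding K_def
    using X by (intro countable_generate) (auto intro: countable_finite)
  have sK: "subgroup K G" unfolding K_def using X by (intro generate_is_subgroup)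
  have XK: "X \<subseteq> K" unfolding K_def by (auto intro: generate.incl)
  have KG: "K \<subseteq> carrier G" using sK by (rule subgroup.subset)
  have oneK: "\<one> \<in> K" using sK by (rule subgroup.one_closed)
  have multK: "x \<otimes> y \<in> K" if "x \<in> K" "y \<in> K" for x y
    using sK that by (rule subgroup.m_closed)
  have invK: "inv x \<in> K" if "x \<in> K" for x
    using sK that by (rule subgroup.m_inv_closed)
  define f where "f = to_nat_on K"
  define g where "g = from_nat_into K"
  have gf: "g (f x) = x" if "x \<in> K" for x
    using that cK by (simp add: f_def g_def)
  define H :: "nat monoid"
    where "H = \<lparr>carrier = f ` K, monoid.mult = (\<lambda>x y. f (g x \<otimes> g y)), one = f \<one>\<rparr>"
  have H: "group H"
  proof (rule groupI)
    fix x assume "x \<in> carrier H"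
    then obtain a where a: "a \<in> K" "x = f a" by (auto simp: H_def)
    show "\<exists>y\<in>carrier H. y \<otimes>\<^bsub>H\<^esub> x = \<one>\<^bsub>H\<^esub>"
      using a KG by (intro bexI[of _ "f (inv a)"]) (auto simp: H_def gf invK subsetD)
  qed (use KG in \<open>auto simp: H_def gf multK oneK m_assoc subsetD\<close>)
  have nH: "nice_tile_over H m n T" using nice H by (simp add: nice_tile_def)
  have inj: "inj_on f K" by (rule inj_on_inverseI[of _ g]) (rule gf)
  have SK: "S \<subseteq> K" using XK by (auto simp: X_def)
  have card: "card (f ` S) = card T"
    using S(3) card_image[OF inj_on_subset[OF inj SK]] by simp
  have rK: "r i \<in> K" if "i \<in> {1..m}" for i using that XK by (auto simp: X_def)
  have cKK: "c j \<in> K" if "j \<in> {1..n}" for j using that XK by (auto simp: X_def)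
  have "f ` S \<subseteq> carrier H" "finite (f ` S)"
    "\<forall>i\<in>{1..m}. f (r i) \<in> carrier H" "\<forall>j\<in>{1..n}. f (c j) \<in> carrier H"
    using SK S(2) rK cKK by (auto simp: H_def)
  note nH[unfolded nice_tile_over_def, THEN conjunct2, THEN spec[of _ "f ` S"],
      THEN spec[of _ "\<lambda>i. f (r i)"], THEN spec[of _ "\<lambda>j. f (c j)"],
      THEN mp, OF this(1), THEN mp, OF this(2), THEN mp, OF card,
      THEN mp, OF this(3), THEN mp, OF this(4)]
  then
  obtain A where A: "pf_array H m n A" "dom A = T"
      "bij_betw (\<lambda>x. the (A x)) T (f ` S)"
    and row: "\<forall>i\<in>{1..m}. row_cells T i \<noteq> {} \<longrightarrow>
              (\<exists>\<beta>\<in>{1..n}. let js = cyc_list n \<beta> (card (row_cells T i)) in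
                 set js = row_cells T i \<and> gsum H (map (\<lambda>j. the (A (i, j))) js) \<noteq> f (r i))"
    and col: "\<forall>j\<in>{1..n}. col_cells T j \<noteq> {} \<longrightarrow>
              (\<exists>\<gamma>\<in>{1..m}. let is = cyc_list m \<gamma> (card (col_cells T j)) in
                 set is = col_cells T j \<and> gsum H (map (\<lambda>i. the (A (i, j))) is) \<noteq> f (c j))"
    by (elim exE conjE) (rule that)
  have AH: "the (A x) \<in> f ` K" if "x \<in> T" for x
  proof -
    from that A(2) obtain y where "A x = Some y" by blast
    then show ?thesis using A(1) ranI[of A x y] by (auto simp: pf_array_def H_def)
  qed
  define A' where "A' = (\<lambda>x. map_option g (A x))"
  have dA': "dom A' = T" using A(2) by (auto simp: A'_def dom_def)
  have A'x: "the (A' x) = g (the (A x))" if "x \<in> T" for x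
    using that A(2) by (auto simp: A'_def dom_def)
  have sum: "gsum H (map f ys) = f (gsum G ys) \<and> gsum G ys \<in> K" if "set ys \<subseteq> K" for ys
    using that by (induction ys) (auto simp: gsum_def H_def gf oneK multK)
  have sumA: "gsum H (map (\<lambda>j. the (A (p j))) js) = f (gsum G (map (\<lambda>j. the (A' (p j))) js))"
    if "\<forall>j\<in>set js. p j \<in> T" for p :: "nat \<Rightarrow> nat \<times> nat" and js
  proof -
    have 1: "the (A' (p j)) \<in> K" "f (the (A' (p j))) = the (A (p j))" if "j \<in> set js" for j
    proof -
      have "p j \<in> T" using that \<open>\<forall>j\<in>set js. p j \<in> T\<close> by blast
      with AH[of "p j"] obtain a where a: "a \<in> K" "the (A (p j)) = f a" by blast
      then show "the (A' (p j)) \<in> K" "f (the (A' (p j))) = the (A (p j))"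
        using A'x[OF \<open>p j \<in> T\<close>] by (simp_all add: gf)
    qed
    then have "map (\<lambda>j. the (A (p j))) js = map f (map (\<lambda>j. the (A' (p j))) js)" by simp
    moreover have "set (map (\<lambda>j. the (A' (p j))) js) \<subseteq> K" using 1 by auto
    ultimately show ?thesis using sum by metis
  qed
  have bij: "bij_betw (\<lambda>x. the (A' x)) T S"
  proof -
    have "bij_betw g (f ` S) S"
      using SK by (intro bij_betw_byWitness[of _ f]) (auto simp: gf subsetD)
    from bij_betw_trans[OF A(3) this] show ?thesis
      by (rule bij_betw_cong[THEN iffD1, rotated]) (simp add: A'x)
  qed
  have pf: "pf_array G m n A'"
  proof -
    have "y \<in> carrier G" if "A' x = Some y" for x y
    proof -
      from that dA' have "x \<in> T" by auto
      then have "the (A' x) \<in> S" using bij_betw_imp_surj_on[OF bij] by blast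
      then show ?thesis using that S(1) by auto
    qed
    then show ?thesis using T dA' unfolding pf_array_def ran_def by blast
  qed
  show "\<exists>A. pf_array G m n A \<and> dom A = T \<and> bij_betw (\<lambda>x. the (A x)) T S \<and>
           (\<forall>i\<in>{1..m}. row_cells T i \<noteq> {} \<longrightarrow>
              (\<exists>\<beta>\<in>{1..n}. let js = cyc_list n \<beta> (card (row_cells T i)) in
                 set js = row_cells T i \<and> gsum G (map (\<lambda>j. the (A (i, j))) js) \<noteq> r i)) \<and>
           (\<forall>j\<in>{1..n}. col_cells T j \<noteq> {} \<longrightarrow>
              (\<exists>\<gamma>\<in>{1..m}. let is = cyc_list m \<gamma> (card (col_cells T j)) in
                 set is = col_cells T j \<and> gsum G (map (\<lambda>i. the (A (i, j))) is) \<noteq> c j))"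
  proof (intro exI[of _ A'] conjI pf dA' bij ballI impI)
    fix i assume i: "i \<in> {1..m}" "row_cells T i \<noteq> {}"
    then obtain \<beta> where b: "\<beta> \<in> {1..n}" and
      *: "set (cyc_list n \<beta> (card (row_cells T i))) = row_cells T i"
      "gsum H (map (\<lambda>j. the (A (i, j))) (cyc_list n \<beta> (card (row_cells T i)))) \<noteq> f (r i)"
      using row unfolding Let_def by blast
    have "\<forall>j\<in>set (cyc_list n \<beta> (card (row_cells T i))). (i, j) \<in> T"
      unfolding *(1) by (simp add: row_cells_def)
    from * b sumA[OF this] show "\<exists>\<beta>\<in>{1..n}. let js = cyc_list n \<beta> (card (row_cells T i)) in
        set js = row_cells T i \<and> gsum G (map (\<lambda>j. the (A' (i, j))) js) \<noteq> r i"
      unfolding Let_def by (metis (no_types, lifting))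
  next
    fix j assume j: "j \<in> {1..n}" "col_cells T j \<noteq> {}"
    then obtain \<gamma> where b: "\<gamma> \<in> {1..m}" and
      *: "set (cyc_list m \<gamma> (card (col_cells T j))) = col_cells T j"
      "gsum H (map (\<lambda>i. the (A (i, j))) (cyc_list m \<gamma> (card (col_cells T j)))) \<noteq> f (c j)"
      using col unfolding Let_def by blast
    have "\<forall>i\<in>set (cyc_list m \<gamma> (card (col_cells T j))). (i, j) \<in> T"
      unfolding *(1) by (simp add: col_cells_def)
    from * b sumA[OF this] show "\<exists>\<gamma>\<in>{1..m}. let is = cyc_list m \<gamma> (card (col_cells T j)) in
        set is = col_cells T j \<and> gsum G (map (\<lambda>i. the (A' (i, j))) is) \<noteq> c j"
      unfolding Let_def by (metis (no_types, lifting))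
  qed
qed

end

theory Submission
  imports Defs
begin

text \<open>
  Choose a sequence \<open>e\<close> in \<open>G - J\<close> such that any \<open>v - t\<close> consecutive terms are distinct and the
  first \<open>n k\<close> terms, together with their inverses, cover \<open>G - J\<close> exactly \<open>l\<close> times: for even \<open>l\<close>
  run \<open>l / 2\<close> times through \<open>G - J\<close>; for odd \<open>l\<close> there are no involutions, so
  \<open>G - J = H \<union> H\<inverse>\<close> disjointly, and one runs through \<open>H, H\<inverse>, H, \<dots>\<close>.
  The tiles are filled one after another with consecutive segments of \<open>e\<close>, keeping all row and
  column sums of the partial array nontrivial. This is possible because a product is trivial iff
  its cyclic rotations are, so each line may be read starting with the new tile, whose sum then
  only has to avoid the inverse of the sum of the remaining entries.
\<close>

section \<open>Cyclic reading orders of a line\<close>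

lemma set_cyc_list_full: "set (cyc_list n b n) = {1..n}"
proof (cases "n = 0")
  case False
  have "y \<in> (\<lambda>s. (b - 1 + s) mod n + 1) ` {0..<n}" if "y \<in> {1..n}" for y
  proof (rule image_eqI)
    \<comment> \<open>The shift from position \<open>b - 1\<close> to position \<open>y - 1\<close>.
      Adding \<open>n\<close> before subtracting avoids truncation on the naturals.\<close>
    let ?s = "(y - 1 + n - (b - 1) mod n) mod n"
    have lt: "(b - 1) mod n < n" using False by simp
    have "(b - 1 + ?s) mod n = ((b - 1) mod n + (y - 1 + n - (b - 1) mod n)) mod n"
      by (simp add: mod_simps)
    also have "\<dots> = (y - 1 + n) mod n" using lt by simp
    also have "\<dots> = y - 1" using that by (cases y) auto
    finally show "y = (b - 1 + ?s) mod n + 1" using that by simp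
    show "?s \<in> {0..<n}" using False by simp
  qed
  then show ?thesis using False
    by (auto simp: cyc_list_def Suc_le_eq)
qed (simp add: cyc_list_def)

lemma length_cyc_list [simp]: "length (cyc_list n b h) = h"
  by (simp add: cyc_list_def)

lemma distinct_cyc_list_full: "distinct (cyc_list n b n)"
  by (rule card_distinct) (simp add: set_cyc_list_full)

lemma cyc_list_split:
  "h \<le> n \<Longrightarrow> cyc_list n b n = cyc_list n b h @ drop h (cyc_list n b n)"
proof -
  assume "h \<le> n"
  then have "take h (cyc_list n b n) = cyc_list n b h"
    by (simp add: cyc_list_def take_map)
  then show ?thesis by (metis append_take_drop_id)
qed

text \<open>Relates the reading that starts at a tile to the order \<open>[1..<Suc n]\<close> in
  which \<open>row_sum\<close> and \<open>col_sum\<close> are taken.\<close>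

lemma cyc_list_rotate: "cyc_list n b n = rotate (b - 1) [1..<Suc n]"
  by (rule nth_equalityI) (auto simp: cyc_list_def nth_rotate simp del: upt_Suc)

text \<open>The start of a proper cyclic interval is its only element whose cyclic predecessor lies
  outside. This fails for \<open>h = n\<close>, where every start gives the whole line.\<close>

lemma cyc_list_start_unique:
  assumes "b \<in> {1..n}" "b' \<in> {1..n}" "0 < h" "h < n"
    and eq: "set (cyc_list n b h) = set (cyc_list n b' h)"
  shows "b = b'"
proof (rule ccontr)
  assume ne: "b \<noteq> b'"
  have "(b - 1 + 0) mod n + 1 \<in> set (cyc_list n b h)"
    unfolding cyc_list_def set_map using assms(3) by (intro imageI) simp
  moreover have "(b - 1 + 0) mod n + 1 = b" using assms(1) by (cases b) auto
  ultimately have "b \<in> set (cyc_list n b h)" by simp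
  then obtain s where s: "s < h" "b = (b' - 1 + s) mod n + 1"
    using eq by (auto simp: cyc_list_def)
  \<comment> \<open>Read from \<open>b'\<close>, the index \<open>b\<close> does not come first, so
    its predecessor also lies in the common set.\<close>
  have "s \<noteq> 0" using s ne assms(2) by (cases b') (auto intro: gr0I)
  then have "(b' - 1 + (s - 1)) mod n + 1 \<in> set (cyc_list n b' h)"
    unfolding cyc_list_def set_map using s by (intro imageI) simp
  then have "(b' - 1 + (s - 1)) mod n + 1 \<in> set (cyc_list n b h)" using eq by simp
  then obtain u where u: "u < h" "(b' - 1 + (s - 1)) mod n = (b - 1 + u) mod n"
    by (auto simp: cyc_list_def)
  \<comment> \<open>The predecessor of \<open>b\<close> is reached from \<open>b\<close> in
    \<open>u\<close> steps, so \<open>u + 1\<close> is a multiple of \<open>n\<close>, although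
    \<open>0 < u + 1 \<le> h < n\<close>.\<close>
  have "(b - 1 + (u + 1)) mod n = ((b - 1 + u) mod n + 1) mod n" by (simp add: mod_simps)
  also have "\<dots> = (b' - 1 + (s - 1) + 1) mod n" unfolding u(2)[symmetric] by (simp only: mod_simps)
  also have "b' - 1 + (s - 1) + 1 = b' - 1 + s" using \<open>s \<noteq> 0\<close> by simp
  also have "(b' - 1 + s) mod n = b - 1" using s by simp
  also have "\<dots> = (b - 1) mod n" using assms(1) by (cases b) auto
  finally have "n dvd b - 1 + (u + 1) - (b - 1)"
    using mod_eq_dvd_iff_nat[of "b - 1" "b - 1 + (u + 1)" n] by simp
  then have "n dvd u + 1" by simp
  then show False using dvd_imp_le[of n "u + 1"] u(1) assms(4) by simp
qed

section \<open>Sums along a line up to rotation, and the value a new tile has to avoid\<close>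

lemma map_filter_append:
  "List.map_filter f (xs @ ys) = List.map_filter f xs @ List.map_filter f ys"
  by (simp add: List.map_filter_def)

lemma set_map_filter_subset: "set (List.map_filter f xs) \<subseteq> ran f"
  by (auto simp: List.map_filter_def ran_def)

context group
begin

lemma gsum_closed [simp]: "set xs \<subseteq> carrier G \<Longrightarrow> gsum G xs \<in> carrier G"
  by (induction xs) (auto simp: gsum_def)

lemma gsum_append:
  "set xs \<subseteq> carrier G \<Longrightarrow> set ys \<subseteq> carrier G \<Longrightarrow> gsum G (xs @ ys) = gsum G xs \<otimes> gsum G ys"
proof (induction xs)
  case Nil
  then show ?case using gsum_closed[of ys] by (simp add: gsum_def)
next
  case (Cons x xs)
  then show ?case using gsum_closed[of ys] gsum_closed[of xs] by (simp add: gsum_def m_assoc)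
qed

text \<open>In any group, \<open>x \<otimes> y = \<one>\<close> and
  \<open>y \<otimes> x = \<one>\<close> both say that \<open>y\<close> is the inverse of
  \<open>x\<close>. Thus triviality, unlike the sum itself, does not depend on the order of the two
  blocks.\<close>

lemma gsum_append_eq_one_commute:
  assumes "set xs \<subseteq> carrier G" "set ys \<subseteq> carrier G"
  shows "gsum G (xs @ ys) = \<one> \<longleftrightarrow> gsum G (ys @ xs) = \<one>"
  using assms by (simp add: gsum_append) (metis gsum_closed inv_comm)

text \<open>A rotation exchanges two blocks of the line, and dropping the empty cells respects this
  splitting.\<close>

lemma gsum_map_filter_rotate_eq_one_iff:
  assumes "ran f \<subseteq> carrier G"
  shows "gsum G (List.map_filter f (rotate d xs)) = \<one> \<longleftrightarrow> gsum G (List.map_filter f xs) = \<one>"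
proof -
  have cl: "set (List.map_filter f ys) \<subseteq> carrier G" for ys
    using assms set_map_filter_subset by (rule order_trans[rotated])
  let ?k = "d mod length xs"
  have "rotate d xs = drop ?k xs @ take ?k xs" by (rule rotate_drop_take)
  moreover have "gsum G (List.map_filter f (drop ?k xs @ take ?k xs)) = \<one> \<longleftrightarrow>
      gsum G (List.map_filter f (take ?k xs @ drop ?k xs)) = \<one>"
    unfolding map_filter_append by (rule gsum_append_eq_one_commute) (rule cl)+
  ultimately show ?thesis by simp
qed

end

text \<open>The value the sum over the new cells \<open>C\<close> of a line has to avoid when \<open>g\<close> holds the entries
  placed so far. The start \<open>b\<close> of \<open>C\<close> is ambiguous only if \<open>C\<close> is the whole line, and then \<open>g\<close> is
  empty.\<close>

definition forbidden :: "('a, 'b) monoid_scheme \<Rightarrow> nat \<Rightarrow> nat set \<Rightarrow> (nat \<rightharpoonup> 'a) \<Rightarrow> 'a" where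
  "forbidden G n C g = inv\<^bsub>G\<^esub> gsum G (List.map_filter g
     (cyc_list n (SOME b. b \<in> {1..n} \<and> set (cyc_list n b (card C)) = C) n))"

context group
begin

lemma forbidden_closed:
  assumes "ran g \<subseteq> carrier G"
  shows "forbidden G n C g \<in> carrier G"
  unfolding forbidden_def
  by (intro inv_closed gsum_closed order_trans[OF set_map_filter_subset assms])

text \<open>Read the line from \<open>b\<close>: the new entries come first, with sum
  \<open>?N\<close>, then the old ones, with sum \<open>?O\<close>. The forbidden value is the
  inverse of \<open>?O\<close>, so the total is nontrivial, and rotating back to
  \<open>[1..<Suc n]\<close> keeps it so.\<close>

lemma line_sum_neq_one:
  assumes g: "ran g \<subseteq> carrier G" "dom g \<inter> C = {}"
    and f: "ran f \<subseteq> carrier G" "dom f = C"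
    and C: "C \<subseteq> {1..n}" "C \<noteq> {}"
    and b: "b \<in> {1..n}" "set (cyc_list n b (card C)) = C"
    and neq: "gsum G (map (\<lambda>j. the (f j)) (cyc_list n b (card C))) \<noteq> forbidden G n C g"
  shows "gsum G (List.map_filter (g ++ f) [1..<Suc n]) \<noteq> \<one>"
proof -
  have h: "0 < card C" "card C \<le> n"
    using C card_mono[OF _ C(1)] by (auto simp: card_gt_0_iff finite_subset)
  define xs where "xs = cyc_list n b (card C)"
  define ys where "ys = drop (card C) (cyc_list n b n)"
  have split: "cyc_list n b n = xs @ ys"
    unfolding xs_def ys_def using h by (intro cyc_list_split)
  have xs: "set xs = C" using b by (simp add: xs_def)
  have ys: "set ys \<inter> C = {}"
    using distinct_cyc_list_full[of n b] unfolding split xs[symmetric] by auto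
  \<comment> \<open>The start picked inside \<open>forbidden\<close>; a priori it need not be
    \<open>b\<close>.\<close>
  define b' where "b' = (SOME b. b \<in> {1..n} \<and> set (cyc_list n b (card C)) = C)"
  have b': "b' \<in> {1..n} \<and> set (cyc_list n b' (card C)) = C"
    unfolding b'_def by (rule someI[of _ b]) (use b in simp)
  have gxs: "List.map_filter g xs = []"
    using xs g(2) by (auto simp: List.map_filter_def filter_empty_conv)
  \<comment> \<open>If \<open>C\<close> is the whole line, both sides are empty; otherwise the start
    of \<open>C\<close> is unique and \<open>b' = b\<close>.\<close>
  have fixs: "List.map_filter g (cyc_list n b' n) = List.map_filter g ys"
  proof (cases "card C = n")
    case True
    then have "C = {1..n}" using C by (intro card_subset_eq) auto
    then have "List.map_filter g (cyc_list n b' n) = []"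
      using g(2) set_cyc_list_full[of n b'] by (auto simp: List.map_filter_def filter_empty_conv)
    moreover have "ys = []" using True by (simp add: ys_def)
    ultimately show ?thesis by (simp add: List.map_filter_def)
  next
    case False
    then have "b' = b" using b b' h by (intro cyc_list_start_unique[of _ n _ "card C"]) auto
    then show ?thesis using gxs by (simp add: split map_filter_append)
  qed
  have cl: "set (List.map_filter u zs) \<subseteq> carrier G" if "ran u \<subseteq> carrier G" for u :: "nat \<rightharpoonup> 'a" and zs
    using that set_map_filter_subset by (rule order_trans[rotated])
  have ran: "ran (g ++ f) \<subseteq> carrier G"
    using f(1) g(1) by (auto simp: ran_def map_add_Some_iff)
  have new: "List.map_filter (g ++ f) xs = map (\<lambda>j. the (f j)) xs"
  proof -
    have "\<forall>j\<in>set xs. (g ++ f) j = f j \<and> f j \<noteq> None"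
      using xs f(2) by (auto simp: map_add_dom_app_simps)
    then show ?thesis by (induction xs) (auto simp: List.map_filter_simps)
  qed
  have old: "List.map_filter (g ++ f) ys = List.map_filter g ys"
  proof -
    have "\<forall>j\<in>set ys. (g ++ f) j = g j"
      using ys f(2) by (metis disjoint_iff map_add_dom_app_simps(3))
    then show ?thesis by (induction ys) (simp_all add: List.map_filter_simps split: option.split)
  qed
  let ?N = "gsum G (List.map_filter (g ++ f) xs)" and ?O = "gsum G (List.map_filter g ys)"
  have "?N \<noteq> inv ?O"
    using neq unfolding forbidden_def b'_def[symmetric] fixs xs_def[symmetric] new .
  then have "?N \<otimes> ?O \<noteq> \<one>"
    using cl[OF ran] cl[OF g(1)] by (metis gsum_closed inv_equality)
  then have "gsum G (List.map_filter (g ++ f) (cyc_list n b n)) \<noteq> \<one>"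
    unfolding split map_filter_append old using gsum_append[OF cl[OF ran] cl[OF g(1)]] by simp
  then show ?thesis
    by (simp only: cyc_list_rotate gsum_map_filter_rotate_eq_one_iff[OF ran] not_False_eq_True)
qed

section \<open>Filling the tiles one after another\<close>

text \<open>Induction on the set of tiles. Injectivity of \<open>e\<close> on every window of length
  \<open>p\<close> turns the next \<open>card T\<close> terms into a set of the size of the next
  tile. The contents are recorded as a multiset because values may recur in different tiles. Sums
  are controlled only on lines that meet \<open>\<Union>P\<close>, since an empty line has sum
  \<open>\<one>\<close>.\<close>

lemma ex_array_filling_tiles:
  assumes "finite P" "disjoint P" "\<forall>T\<in>P. nice_tile_over G m n T \<and> card T \<le> p"
    and e: "range e \<subseteq> carrier G" "\<And>N. inj_on e {N..<N + p}"
  shows "\<exists>A. pf_array G m n A \<and> dom A = \<Union>P \<and>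
    image_mset (\<lambda>x. the (A x)) (mset_set (\<Union>P)) = image_mset e (mset_set {..<card (\<Union>P)}) \<and>
    (\<forall>i\<in>{1..m}. row_cells (\<Union>P) i \<noteq> {} \<longrightarrow> row_sum G n A i \<noteq> \<one>) \<and>
    (\<forall>j\<in>{1..n}. col_cells (\<Union>P) j \<noteq> {} \<longrightarrow> col_sum G m A j \<noteq> \<one>)"
  using assms(1-3)
proof (induction P rule: finite_induct)
  case empty
  show ?case
    by (intro exI[of _ Map.empty]) (auto simp: pf_array_def row_cells_def col_cells_def)
next
  case (insert T P)
  define U where "U = \<Union>P"
  have fin: "finite (cells m n)" by (simp add: cells_def)
  have T: "T \<subseteq> cells m n" "card T \<le> p" and nice: "nice_tile_over G m n T"
    using insert.prems by (auto simp: nice_tile_over_def)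
  have Usub: "U \<subseteq> cells m n"
    using insert.prems by (auto simp: U_def nice_tile_over_def)
  have finTU: "finite T" "finite U" using T Usub fin by (auto intro: finite_subset)
  have disj: "U \<inter> T = {}"
    using insert.prems(1) insert.hyps(2) by (auto simp: U_def pairwise_def disjnt_def)
  have "disjoint P" using insert.prems(1) by (auto simp: pairwise_def)
  with insert obtain A where A: "pf_array G m n A" "dom A = U"
    and mA: "image_mset (\<lambda>x. the (A x)) (mset_set U) = image_mset e (mset_set {..<card U})"
    and rowA: "\<forall>i\<in>{1..m}. row_cells U i \<noteq> {} \<longrightarrow> row_sum G n A i \<noteq> \<one>"
    and colA: "\<forall>j\<in>{1..n}. col_cells U j \<noteq> {} \<longrightarrow> col_sum G m A j \<noteq> \<one>"
    unfolding U_def by auto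
  \<comment> \<open>The first \<open>card U\<close> terms of \<open>e\<close> are already placed;
    the new tile receives the segment that follows.\<close>
  define S where "S = e ` {card U..<card U + card T}"
  have injT: "inj_on e {card U..<card U + card T}"
    using T(2) by (intro inj_on_subset[OF e(2)[of "card U"]]) auto
  have S: "S \<subseteq> carrier G" "finite S" "card S = card T"
    using e(1) injT by (auto simp: S_def card_image)
  have ranA: "ran (\<lambda>j. A (i, j)) \<subseteq> carrier G" "ran (\<lambda>i. A (i, j)) \<subseteq> carrier G" for i j
    using A(1) by (auto simp: pf_array_def ran_def)
  \<comment> \<open>The vectors for the nice tile are chosen to exclude the one value per line that
    would make the enlarged line sum trivial.\<close>
  define r where "r i = forbidden G n (row_cells T i) (\<lambda>j. A (i, j))" for i
  define c where "c j = forbidden G m (col_cells T j) (\<lambda>i. A (i, j))" for j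
  have rc: "\<forall>i\<in>{1..m}. r i \<in> carrier G" "\<forall>j\<in>{1..n}. c j \<in> carrier G"
    unfolding r_def c_def using forbidden_closed ranA by blast+
  note nice[unfolded nice_tile_over_def, THEN conjunct2, THEN spec[of _ S], THEN spec[of _ r],
      THEN spec[of _ c], THEN mp, OF S(1), THEN mp, OF S(2), THEN mp, OF S(3),
      THEN mp, OF rc(1), THEN mp, OF rc(2)]
  then obtain F where F: "pf_array G m n F" "dom F = T" and bij: "bij_betw (\<lambda>x. the (F x)) T S"
    and rowF: "\<forall>i\<in>{1..m}. row_cells T i \<noteq> {} \<longrightarrow>
        (\<exists>\<beta>\<in>{1..n}. let js = cyc_list n \<beta> (card (row_cells T i)) in
           set js = row_cells T i \<and> gsum G (map (\<lambda>j. the (F (i, j))) js) \<noteq> r i)"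
    and colF: "\<forall>j\<in>{1..n}. col_cells T j \<noteq> {} \<longrightarrow>
        (\<exists>\<gamma>\<in>{1..m}. let is = cyc_list m \<gamma> (card (col_cells T j)) in
           set is = col_cells T j \<and> gsum G (map (\<lambda>i. the (F (i, j))) is) \<noteq> c j)"
    by (elim exE conjE) (rule that)
  have ranF: "ran (\<lambda>j. F (i, j)) \<subseteq> carrier G" "ran (\<lambda>i. F (i, j)) \<subseteq> carrier G" for i j
    using F(1) by (auto simp: pf_array_def ran_def)
  have lines: "(\<lambda>j. (A ++ F) (i, j)) = (\<lambda>j. A (i, j)) ++ (\<lambda>j. F (i, j))"
    "(\<lambda>i. (A ++ F) (i, j)) = (\<lambda>i. A (i, j)) ++ (\<lambda>i. F (i, j))" for i j
    by (auto simp: map_add_def)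
  have U': "\<Union>(insert T P) = U \<union> T" by (auto simp: U_def)
  show ?case unfolding U'
  proof (intro exI[of _ "A ++ F"] conjI ballI impI)
    show "pf_array G m n (A ++ F)"
    proof -
      have "ran (A ++ F) \<subseteq> ran A \<union> ran F" by (force simp: ran_def map_add_Some_iff)
      then show ?thesis using A(1) F(1) by (auto simp: pf_array_def)
    qed
    show "dom (A ++ F) = U \<union> T" using A(2) F(2) by auto
    \<comment> \<open>The old cells contribute the initial segment of \<open>e\<close> and the new
      ones the adjacent segment, which together form a longer initial segment.\<close>
    have "image_mset (\<lambda>x. the ((A ++ F) x)) (mset_set (U \<union> T)) =
        image_mset (\<lambda>x. the ((A ++ F) x)) (mset_set U) +
        image_mset (\<lambda>x. the ((A ++ F) x)) (mset_set T)"
      using finTU disj by (simp add: mset_set_Union)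
    also have "image_mset (\<lambda>x. the ((A ++ F) x)) (mset_set U) = image_mset (\<lambda>x. the (A x)) (mset_set U)"
      using finTU disj F(2)
      by (intro image_mset_cong) (metis disjoint_iff finite_set_mset_mset_set map_add_dom_app_simps(3))
    also have "image_mset (\<lambda>x. the ((A ++ F) x)) (mset_set T) = image_mset (\<lambda>x. the (F x)) (mset_set T)"
      using finTU F(2) by (intro image_mset_cong) (auto simp: map_add_dom_app_simps)
    also have "\<dots> = mset_set S"
      using bij by (simp add: bij_betw_def image_mset_mset_set)
    also have "\<dots> = image_mset e (mset_set {card U..<card U + card T})"
      unfolding S_def using injT by (simp add: image_mset_mset_set)
    also note mA
    also have "image_mset e (mset_set {..<card U}) + image_mset e (mset_set {card U..<card U + card T})
        = image_mset e (mset_set ({..<card U} \<union> {card U..<card U + card T}))"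
      by (subst mset_set_Union) auto
    also have "{..<card U} \<union> {card U..<card U + card T} = {..<card (U \<union> T)}"
      using finTU disj by (auto simp: card_Un_disjoint)
    finally show "image_mset (\<lambda>x. the ((A ++ F) x)) (mset_set (U \<union> T)) =
        image_mset e (mset_set {..<card (U \<union> T)})" .
  next
    fix i assume i: "i \<in> {1..m}" "row_cells (U \<union> T) i \<noteq> {}"
    show "row_sum G n (A ++ F) i \<noteq> \<one>"
    proof (cases "row_cells T i = {}")
      case True
      \<comment> \<open>The new tile misses this row, so the row is unchanged and the induction
        hypothesis applies.\<close>
      then have "dom (\<lambda>j. F (i, j)) = {}" using F(2) by (auto simp: row_cells_def)
      then have "(\<lambda>j. F (i, j)) = Map.empty" by simp
      moreover have "row_cells U i \<noteq> {}" using True i(2) by (auto simp: row_cells_def)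
      ultimately show ?thesis using i rowA by (simp add: row_sum_def lines del: upt_Suc)
    next
      case False
      then obtain b where b: "b \<in> {1..n}"
        "set (cyc_list n b (card (row_cells T i))) = row_cells T i"
        "gsum G (map (\<lambda>j. the (F (i, j))) (cyc_list n b (card (row_cells T i)))) \<noteq> r i"
        using rowF i(1) unfolding Let_def by blast
      show ?thesis unfolding row_sum_def lines
      proof (rule line_sum_neq_one[OF ranA(1) _ ranF(1) _ _ False b(1,2) b(3)[unfolded r_def]])
        show "dom (\<lambda>j. A (i, j)) \<inter> row_cells T i = {}"
          using A(2) disj by (auto simp: row_cells_def)
        show "dom (\<lambda>j. F (i, j)) = row_cells T i" using F(2) by (auto simp: row_cells_def)
        show "row_cells T i \<subseteq> {1..n}" using T by (auto simp: row_cells_def cells_def)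
      qed
    qed
  next
    fix j assume j: "j \<in> {1..n}" "col_cells (U \<union> T) j \<noteq> {}"
    show "col_sum G m (A ++ F) j \<noteq> \<one>"
    proof (cases "col_cells T j = {}")
      case True
      then have "dom (\<lambda>i. F (i, j)) = {}" using F(2) by (auto simp: col_cells_def)
      then have "(\<lambda>i. F (i, j)) = Map.empty" by simp
      moreover have "col_cells U j \<noteq> {}" using True j(2) by (auto simp: col_cells_def)
      ultimately show ?thesis using j colA by (simp add: col_sum_def lines del: upt_Suc)
    next
      case False
      then obtain b where b: "b \<in> {1..m}"
        "set (cyc_list m b (card (col_cells T j))) = col_cells T j"
        "gsum G (map (\<lambda>i. the (F (i, j))) (cyc_list m b (card (col_cells T j)))) \<noteq> c j"
        using colF j(1) unfolding Let_def by blast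
      show ?thesis unfolding col_sum_def lines
      proof (rule line_sum_neq_one[OF ranA(2) _ ranF(2) _ _ False b(1,2) b(3)[unfolded c_def]])
        show "dom (\<lambda>i. A (i, j)) \<inter> col_cells T j = {}"
          using A(2) disj by (auto simp: col_cells_def)
        show "dom (\<lambda>i. F (i, j)) = col_cells T j" using F(2) by (auto simp: col_cells_def)
        show "col_cells T j \<subseteq> {1..m}" using T by (auto simp: col_cells_def cells_def)
      qed
    qed
  qed
qed

end

section \<open>Sequences with distinct windows and prescribed multiplicities\<close>

text \<open>A fixed-point-free involution splits \<open>D\<close> into pairs. Remove one pair
  \<open>{x, f x}\<close>, halve the rest by induction, and put \<open>x\<close> into
  \<open>H\<close>.\<close>

lemma ex_half_of_involution:
  assumes "finite D" "\<forall>x\<in>D. f x \<in> D \<and> f (f x) = x \<and> f x \<noteq> x"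
  shows "\<exists>H. D = H \<union> f ` H \<and> H \<inter> f ` H = {}"
  using assms
proof (induction D rule: finite_psubset_induct)
  case (psubset D)
  show ?case
  proof (cases "D = {}")
    case False
    then obtain x where x: "x \<in> D" by blast
    let ?D = "D - {x, f x}"
    have "\<forall>y\<in>?D. f y \<in> ?D \<and> f (f y) = y \<and> f y \<noteq> y"
      using psubset.prems x by (metis Diff_iff empty_iff insert_iff)
    moreover have "?D \<subset> D" using x by blast
    ultimately have "\<exists>H. ?D = H \<union> f ` H \<and> H \<inter> f ` H = {}"
      by (intro psubset.IH)
    then obtain H where H: "?D = H \<union> f ` H" "H \<inter> f ` H = {}"
      by (elim exE conjE)
    have "f x \<noteq> x" "f x \<in> D" using psubset.prems x by auto
    then have "D = insert x H \<union> f ` insert x H" "insert x H \<inter> f ` insert x H = {}"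
      using H x by auto
    then show ?thesis by blast
  qed auto
qed

text \<open>Cuts the indices into \<open>q\<close> blocks of length \<open>s\<close>. It serves both
  parities of \<open>l\<close>: blocks of length \<open>card D\<close> for even \<open>l\<close>, of
  half that length for odd \<open>l\<close>.\<close>

lemma image_mset_blocks:
  assumes "\<And>q. image_mset e (mset_set {q * s..<q * s + s}) +
      image_mset g (mset_set {q * s..<q * s + s}) = Q"
  shows "image_mset e (mset_set {..<q * s}) + image_mset g (mset_set {..<q * s}) =
    repeat_mset q Q"
proof (induction q)
  case (Suc q)
  have "{..<Suc q * s} = {..<q * s} \<union> {q * s..<q * s + s}" by auto
  moreover have "{..<q * s} \<inter> {q * s..<q * s + s} = {}" by auto
  ultimately have split: "mset_set {..<Suc q * s} = mset_set {..<q * s} + mset_set {q * s..<q * s + s}"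
    by (simp only: mset_set_Union finite_lessThan finite_atLeastLessThan)
  have "image_mset e (mset_set {..<Suc q * s}) + image_mset g (mset_set {..<Suc q * s}) =
      (image_mset e (mset_set {..<q * s}) + image_mset g (mset_set {..<q * s})) +
      (image_mset e (mset_set {q * s..<q * s + s}) + image_mset g (mset_set {q * s..<q * s + s}))"
    unfolding split image_mset_union by (simp only: ac_simps)
  then show ?case unfolding Suc assms by simp
qed simp

text \<open>A window as long as the period meets each residue class once, even when it wraps around
  the end of the list.\<close>

lemma inj_on_nth_mod:
  assumes "distinct xs"
  shows "inj_on (\<lambda>i. xs ! (i mod length xs)) {N..<N + length xs}"
proof (rule inj_onI)
  fix i j assume i: "i \<in> {N..<N + length xs}" and j: "j \<in> {N..<N + length xs}"
    and "xs ! (i mod length xs) = xs ! (j mod length xs)"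
  moreover from i have "length xs > 0" by auto
  ultimately have "i mod length xs = j mod length xs"
    using assms by (simp add: nth_eq_iff_index_eq)
  moreover have "a = b" if "a \<le> b" "b < a + length xs" "a mod length xs = b mod length xs" for a b
  proof -
    have "length xs dvd b - a" using that mod_eq_dvd_iff_nat[of a b "length xs"] by metis
    then show ?thesis using that nat_dvd_not_less[of "b - a" "length xs"] by fastforce
  qed
  moreover have "i < j + length xs" "j < i + length xs" using i j by auto
  ultimately show "i = j" by (metis nat_le_linear)
qed

text \<open>To be used with \<open>D\<close> the complement of \<open>J\<close>, \<open>f\<close>
  the group inversion and \<open>N = n * k\<close>. Fixed points of \<open>f\<close> are then the
  involutions outside \<open>J\<close>.\<close>

lemma ex_cyclic_sequence:
  assumes "finite D" and f: "\<forall>x\<in>D. f x \<in> D \<and> f (f x) = x" and ne: "D \<noteq> {}"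
    and fixpoints: "(\<exists>x\<in>D. f x = x) \<Longrightarrow> even l"
    and N: "card D * l = 2 * N"
  shows "\<exists>e. range e \<subseteq> D \<and> (\<forall>M. inj_on e {M..<M + card D}) \<and>
    image_mset e (mset_set {..<N}) + image_mset (f \<circ> e) (mset_set {..<N}) =
      repeat_mset l (mset_set D)"
proof -
  have fD: "f ` D = D" using f by (force intro: image_eqI)
  have injf: "inj_on f D" using f by (metis inj_onI)
  have imf: "image_mset f (mset_set D) = mset_set D"
    using fD injf by (simp add: image_mset_mset_set)
  show ?thesis
  proof (cases "even l")
    case True
    then obtain q where q: "l = 2 * q" by blast
    obtain xs where xs: "set xs = D" "distinct xs" using finite_distinct_list assms(1) by blast
    have len: "length xs = card D" using xs distinct_card by metis
    define e where "e = (\<lambda>i. xs ! (i mod length xs))"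
    have pos: "length xs > 0" using xs ne by auto
    have inj: "inj_on e {M..<M + card D}" for M
      using inj_on_nth_mod[OF xs(2)] by (simp add: e_def len)
    have ran: "range e \<subseteq> D" using xs pos by (auto simp: e_def)
    have win: "image_mset e (mset_set {M..<M + card D}) = mset_set D" for M
    proof -
      have "e ` {M..<M + card D} = D"
        using ran assms(1) inj by (intro card_subset_eq) (auto simp: card_image)
      then show ?thesis using inj by (simp add: image_mset_mset_set)
    qed
    \<comment> \<open>The inverses of a full period again exhaust \<open>D\<close>, so each period
      contributes every element twice and \<open>q = l / 2\<close> periods suffice.\<close>
    have "image_mset (f \<circ> e) (mset_set {M..<M + card D}) = mset_set D" for M
      by (simp add: image_mset.compositionality[symmetric] win imf)
    then have "image_mset e (mset_set {..<q * card D}) + image_mset (f \<circ> e) (mset_set {..<q * card D})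
        = repeat_mset q (mset_set D + mset_set D)"
      by (intro image_mset_blocks) (simp add: win)
    moreover have "q * card D = N" using N q by (simp add: ac_simps)
    moreover have "repeat_mset q (mset_set D + mset_set D) = repeat_mset l (mset_set D)"
      unfolding q by (rule multiset_eqI) simp
    ultimately show ?thesis using inj ran by (intro exI[of _ e]) simp
  next
    case False
    \<comment> \<open>As \<open>l\<close> is odd, \<open>f\<close> has no fixed points in
      \<open>D\<close>, so \<open>D\<close> can be halved.\<close>
    then obtain H where H: "D = H \<union> f ` H" "H \<inter> f ` H = {}"
      using ex_half_of_involution[OF assms(1), of f] f fixpoints by blast
    have finH: "finite H" using H(1) assms(1) by simp
    then obtain xs where xs: "set xs = H" "distinct xs" using finite_distinct_list by blast
    have injH: "inj_on f H" using injf H(1) by (metis Un_upper1 inj_on_subset)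
    define s where "s = length xs"
    define ys where "ys = xs @ map f xs"
    have ys: "set ys = D" "distinct ys" using xs H injH by (auto simp: ys_def distinct_map)
    have len: "length ys = card D" using ys distinct_card by metis
    have len2: "length ys = 2 * s" by (simp add: ys_def s_def)
    have pos: "s > 0" using ne ys len2 by (cases "s = 0") auto
    define e where "e = (\<lambda>i. ys ! (i mod (2 * s)))"
    have ran: "range e \<subseteq> D" using ys pos len2 by (auto simp: e_def)
    have inj: "inj_on e {M..<M + card D}" for M
      using inj_on_nth_mod[OF ys(2), of M] by (simp add: e_def len2 flip: len)
    \<comment> \<open>One period of \<open>e\<close> lists \<open>H\<close> and then its image under
      \<open>f\<close>, so the half-period with number \<open>q\<close> is determined by the parity
      of \<open>q\<close>.\<close>
    have block: "image_mset e (mset_set {q * s..<q * s + s}) =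
        (if even q then mset_set H else image_mset f (mset_set H))" for q
    proof -
      have "mset_set {q * s..<q * s + s} = mset [q * s..<q * s + s]"
        by (simp add: mset_upt)
      also have "[q * s..<q * s + s] = map (\<lambda>i. i + q * s) [0..<s]"
        by (simp add: map_add_upt add.commute)
      finally have *: "image_mset e (mset_set {q * s..<q * s + s}) =
          mset (map (\<lambda>i. e (i + q * s)) [0..<s])"
        by (simp add: image_mset.compositionality comp_def)
      show ?thesis
      proof (cases "even q")
        case True
        then obtain u where u: "q = 2 * u" by blast
        have "e (i + q * s) = xs ! i" if "i < s" for i
        proof -
          have "(i + q * s) mod (2 * s) = (i + u * (2 * s)) mod (2 * s)"
            by (simp add: u ac_simps)
          also have "\<dots> = i" using that by (simp only: mod_mult_self1) simp
          finally show ?thesis using that by (simp add: e_def ys_def nth_append s_def)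
        qed
        then have "map (\<lambda>i. e (i + q * s)) [0..<s] = xs"
          by (intro nth_equalityI) (auto simp: s_def)
        then show ?thesis using * True mset_set_set[OF xs(2)] xs(1) by simp
      next
        case False
        then obtain u where u: "q = 2 * u + 1" by (elim oddE)
        have "e (i + q * s) = f (xs ! i)" if "i < s" for i
        proof -
          have "(i + q * s) mod (2 * s) = ((i + s) + u * (2 * s)) mod (2 * s)"
            by (simp add: u algebra_simps)
          also have "\<dots> = i + s" using that by (simp only: mod_mult_self1) simp
          finally show ?thesis using that by (simp add: e_def ys_def nth_append s_def)
        qed
        then have "map (\<lambda>i. e (i + q * s)) [0..<s] = map f xs"
          by (intro nth_equalityI) (auto simp: s_def)
        then show ?thesis using * False mset_set_set[OF xs(2)] xs(1) by simp
      qed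
    qed
    have D: "mset_set D = mset_set H + image_mset f (mset_set H)"
      using H finH injH by (simp add: mset_set_Union image_mset_mset_set)
    have ff: "image_mset f (image_mset f (mset_set H)) = mset_set H"
    proof -
      have "image_mset (f \<circ> f) (mset_set H) = image_mset id (mset_set H)"
        using finH f H(1) by (intro image_mset_cong) auto
      then show ?thesis by (simp add: image_mset.compositionality)
    qed
    \<comment> \<open>Whichever half a block lists, applying \<open>f\<close> supplies the other
      half, so each block contributes \<open>D\<close> exactly once.\<close>
    have "image_mset e (mset_set {..<l * s}) + image_mset (f \<circ> e) (mset_set {..<l * s})
        = repeat_mset l (mset_set D)"
    proof (rule image_mset_blocks)
      fix q
      have eq: "image_mset (f \<circ> e) (mset_set {q * s..<q * s + s}) =
          image_mset f (image_mset e (mset_set {q * s..<q * s + s}))"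
        by (simp add: image_mset.compositionality)
      show "image_mset e (mset_set {q * s..<q * s + s}) +
          image_mset (f \<circ> e) (mset_set {q * s..<q * s + s}) = mset_set D"
        unfolding eq block D by (simp add: ff)
    qed
    moreover have "l * s = N"
    proof -
      have "card D = 2 * s" using len len2 by simp
      then show ?thesis using N by (simp add: ac_simps)
    qed

    ultimately show ?thesis using inj ran by (intro exI[of _ e]) simp
  qed
qed

section \<open>Assembling the array over \<open>G\<close> relative to \<open>J\<close>\<close>

theorem theorem4p4:
  fixes G :: "('a, 'b) monoid_scheme" and J :: "'a set"
    and B :: "(nat \<times> nat) set" and P :: "(nat \<times> nat) set set"
    and m n h k v t l :: nat
  assumes pos: "m > 0" "n > 0" "h > 0" "k > 0"
    and B: "B \<subseteq> cells m n"
    and B_rows: "\<forall>i\<in>{1..m}. card (row_cells B i) = h"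
    and B_cols: "\<forall>j\<in>{1..n}. card (col_cells B j) = k"
    and G: "group G" "finite (carrier G)" "order G = v"
    and J: "subgroup J G" "card J = t"
    and l: "l > 0"
    and nk: "n * k = m * h"
    and v: "real v = 2 * real n * real k / real l + real t"
    and t: "t dvd v"
    and invol: "(\<exists>x\<in>carrier G - J. x \<noteq> \<one>\<^bsub>G\<^esub> \<and> x \<otimes>\<^bsub>G\<^esub> x = \<one>\<^bsub>G\<^esub>) \<Longrightarrow> even l"
    and P: "partition_on B P" "\<forall>T\<in>P. nice_tile m n T"
    and size: "v - t \<ge> Max (card ` P)"
  shows "\<exists>A. is_NH G J l t m n h k A"
proof -
  interpret group G by (rule G(1))
  define D where "D = carrier G - J"
  have JG: "J \<subseteq> carrier G" using J(1) by (rule subgroup.subset)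
  have finD: "finite D" using G(2) by (simp add: D_def)
  have "card D = card (carrier G) - card J"
    unfolding D_def using G(2) JG by (intro card_Diff_subset) (auto intro: finite_subset)
  then have cD: "card D = v - t" using G(3) J(2) by (simp add: order_def)
  have tv: "t \<le> v" using card_mono[OF G(2) JG] G(3) J(2) by (simp add: order_def)
  have "real (card D * l) = real (2 * (n * k))"
    using v l tv by (simp add: cD of_nat_diff field_simps)
  then have Dl: "card D * l = 2 * (n * k)" using of_nat_eq_iff by blast
  then have ne: "D \<noteq> {}" using pos by auto
  have invD: "m_inv G x \<in> D \<and> m_inv G (m_inv G x) = x" if "x \<in> D" for x
    using that J(1) by (auto simp: D_def) (metis inv_inv subgroup.m_inv_closed)
  \<comment> \<open>An element of \<open>D\<close> equal to its own inverse is a genuine involution,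
    because \<open>\<one>\<close> lies in \<open>J\<close>.\<close>
  have "even l" if fixed: "\<exists>x\<in>D. m_inv G x = x"
  proof (rule invol)
    from fixed obtain x where x: "x \<in> D" "m_inv G x = x" by blast
    then have "x \<otimes>\<^bsub>G\<^esub> x = \<one>\<^bsub>G\<^esub>" by (metis D_def DiffD1 r_inv)
    moreover have "x \<noteq> \<one>\<^bsub>G\<^esub>" using x subgroup.one_closed[OF J(1)] by (auto simp: D_def)
    ultimately show "\<exists>x\<in>carrier G - J. x \<noteq> \<one>\<^bsub>G\<^esub> \<and> x \<otimes>\<^bsub>G\<^esub> x = \<one>\<^bsub>G\<^esub>" using x by (auto simp: D_def)
  qed
  with ex_cyclic_sequence[OF finD _ ne _ Dl, of "m_inv G"] invD
  obtain e where e: "range e \<subseteq> D" "\<And>M. inj_on e {M..<M + card D}"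
    "image_mset e (mset_set {..<n * k}) + image_mset (m_inv G \<circ> e) (mset_set {..<n * k}) =
      repeat_mset l (mset_set D)"
    by blast
  have finB: "finite B" using B by (rule finite_subset) (simp add: cells_def)
  have UP: "\<Union>P = B" "disjoint P" using P(1) by (auto simp: partition_on_def)
  have finP: "finite P" using finB UP(1) by (metis finite_UnionD)
  \<comment> \<open>The size hypothesis bounds every tile by \<open>card D\<close>, the length of
    the windows on which \<open>e\<close> is injective.\<close>
  have tiles: "\<forall>T\<in>P. nice_tile_over G m n T \<and> card T \<le> card D"
  proof
    fix T assume T: "T \<in> P"
    then have "card T \<le> Max (card ` P)" using finP by (intro Max_ge) auto
    then show "nice_tile_over G m n T \<and> card T \<le> card D"
      using nice_tile_any_group[OF _ G(1)] P(2) T size cD by auto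
  qed
  have cardB: "card B = n * k"
  proof -
    have "B = (SIGMA i:{1..m}. row_cells B i)" using B by (auto simp: row_cells_def cells_def)
    \<comment> \<open>Counting by rows gives \<open>m * h\<close>, which equals
      \<open>n * k\<close>; hence the tiles use exactly the first \<open>n * k\<close> terms of
      \<open>e\<close>.\<close>
    then have "card B = (\<Sum>i\<in>{1..m}. card (row_cells B i))"
      using finB card_SigmaI[of "{1..m}" "row_cells B"] B_rows pos(3)
      by (metis card.infinite finite_atLeastAtMost less_irrefl)
    then show ?thesis using B_rows nk by simp
  qed
  from ex_array_filling_tiles[OF finP UP(2) tiles _ e(2)] e(1)
  obtain A where A: "pf_array G m n A" "dom A = B"
    "image_mset (\<lambda>x. the (A x)) (mset_set B) = image_mset e (mset_set {..<n * k})"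
    "\<forall>i\<in>{1..m}. row_cells B i \<noteq> {} \<longrightarrow> row_sum G n A i \<noteq> \<one>\<^bsub>G\<^esub>"
    "\<forall>j\<in>{1..n}. col_cells B j \<noteq> {} \<longrightarrow> col_sum G m A j \<noteq> \<one>\<^bsub>G\<^esub>"
    unfolding UP cardB D_def by blast
  have "image_mset (\<lambda>x. m_inv G (the (A x))) (mset_set B) = image_mset (m_inv G \<circ> e) (mset_set {..<n * k})"
    using arg_cong[OF A(3), of "image_mset (m_inv G)"]
    by (simp add: image_mset.compositionality comp_def)
  \<comment> \<open>Since \<open>h\<close> and \<open>k\<close> are positive, every line meets
    \<open>B\<close>, and the conditional statements about sums cover all rows and columns.\<close>
  moreover have "row_cells B i \<noteq> {}" if "i \<in> {1..m}" for i
    using B_rows pos(3) that by (metis card.empty less_irrefl)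
  moreover have "col_cells B j \<noteq> {}" if "j \<in> {1..n}" for j
    using B_cols pos(4) that by (metis card.empty less_irrefl)
  ultimately have "is_NH G J l t m n h k A"
    unfolding is_NH_def A(2) D_def[symmetric]
    using G(1,2) J A(1,3-5) e(3) B_rows B_cols pos by auto
  then show ?thesis by blast
qed

end
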